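(* Let $1 \leq p < \infty$. If $(f_n)_n$ is a bounded sequence in $H_p(\mathbb{D})$ (that is, $\sup_n\Vert f_n\Vert_{H_p(\mathbb{D})}<\infty$), then there exist $f \in H_p(\mathbb{D})$ and a subsequence $(f_{n_k})_k$ that converges to $f$ uniformly on the compact subsets of $\mathbb{D}$.
   Context: $\mathbb{D}$ is the open unit disc of $\mathbb{C}$ and $\mathbb{T}=\{z\in\mathbb{C}:|z|=1\}$ with the normalised Lebesgue measure. For $1\le p<\infty$, $H_p(\mathbb{D})$ is the space of holomorphic functions $f:\mathbb{D}\to\mathbb{C}$ such that $$\Vert f \Vert_{H_{p}(\mathbb{D})} = \sup_{0<r<1} \bigg(\int_{\mathbb{T}} |f(rw)|^{p}\, \mathrm{d}w \bigg)^{1/p}<\infty.$$ *)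

theory Defs
  imports "HOL-Complex_Analysis.Complex_Analysis"
begin

(* Its space is the circle itself rather than all of the plane, so that
   measurability of w |-> f (r w) involves only the values of f on the disc. *)
definition circle_measure :: "complex measure" where
  "circle_measure =
     distr (uniform_measure lborel {0..<2 * pi}) (restrict_space borel (sphere 0 1)) cis"

(* Takes the value infinity when the supremum is infinite. Intended for f holomorphic
   on the unit disc: the integrands are then continuous on the circle, hence integrable. *)
definition hardy_norm :: "real \<Rightarrow> (complex \<Rightarrow> complex) \<Rightarrow> ennreal" where
  "hardy_norm p f =
     (SUP r\<in>{0<..<1::real}.
        ennreal ((\<integral>w. norm (f (of_real r * w)) powr p \<partial>circle_measure) powr (1 / p)))"

(* Functions on the disc are total functions whose values outside it are irrelevant. *)
definition hardy_space :: "real \<Rightarrow> (complex \<Rightarrow> complex) set" where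
  "hardy_space p = {f. f holomorphic_on ball 0 1 \<and> hardy_norm p f < \<infinity>}"

end

theory Submission
  imports Defs "HOL-Probability.Probability_Measure"
begin

(* On a compact subset of the disc the Cauchy formula over a larger circle, together with
   t \<le> 1 + t^p, bounds f by its Hardy norm, so the sequence is a normal family and
   Montel's theorem gives a locally uniform limit. On each circle |z| = r the sequence is uniformly
   bounded, so by dominated convergence the p-th power means pass to the limit and keep the bound. *)

lemma space_circle_measure [simp]: "space circle_measure = sphere 0 1"
  by (simp add: circle_measure_def space_restrict_space)

lemma sets_circle_measure [measurable_cong]:
  "sets circle_measure = sets (restrict_space borel (sphere 0 1))"
  by (simp add: circle_measure_def)

lemma measurable_cis [measurable]:
  "cis \<in> uniform_measure lborel S \<rightarrow>\<^sub>M restrict_space borel (sphere 0 1)"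
proof (rule measurable_restrict_space2)
  have "cis \<in> borel_measurable borel"
    by (intro borel_measurable_continuous_onI continuous_intros)
  then show "cis \<in> uniform_measure lborel S \<rightarrow>\<^sub>M borel"
    by (simp add: uniform_measure_def)
qed auto

lemma prob_space_circle_measure: "prob_space circle_measure"
  unfolding circle_measure_def
  by (intro prob_space.prob_space_distr prob_space_uniform_measure measurable_cis) auto

text \<open>The sigma-algebra of \<open>circle_measure\<close> lives on the sphere alone, so the
  behaviour of \<open>F\<close> off the sphere does not enter.\<close>

lemma continuous_on_sphere_measurable:
  assumes "continuous_on (sphere 0 1) F"
  shows "F \<in> borel_measurable circle_measure"
  using borel_measurable_continuous_on_restrict[OF assms]
  unfolding measurable_cong_sets[OF sets_circle_measure refl] .

lemma continuous_on_sphere_integrable: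
  fixes F :: "complex \<Rightarrow> 'a :: {banach, second_countable_topology}"
  assumes "continuous_on (sphere 0 1) F"
  shows "integrable circle_measure F"
proof -
  interpret prob_space circle_measure
    by (rule prob_space_circle_measure)
  have "bounded (F ` sphere 0 1)"
    using assms by (intro compact_imp_bounded compact_continuous_image) auto
  then obtain B where "\<And>w. w \<in> sphere 0 1 \<Longrightarrow> norm (F w) \<le> B"
    unfolding bounded_iff by blast
  then show ?thesis
    by (intro integrable_const_bound[of _ B] AE_I2 continuous_on_sphere_measurable[OF assms]) simp
qed

text \<open>Links \<open>circle_measure\<close> to the gauge integral over an angle, the form that a
  contour integral along \<open>circlepath\<close> takes once parametrised.\<close>

lemma has_integral_circle_measure:
  fixes F :: "complex \<Rightarrow> 'a :: euclidean_space"
  assumes F: "continuous_on (sphere 0 1) F"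
  shows "((\<lambda>t. F (cis t)) has_integral (2 * pi) *\<^sub>R (\<integral>w. F w \<partial>circle_measure)) {0..2 * pi}"
proof -
  have cont: "continuous_on UNIV (\<lambda>t. F (cis t))"
    by (rule continuous_on_compose2[OF F]) (auto intro!: continuous_intros)
  then have meas: "(\<lambda>t. F (cis t)) \<in> borel_measurable borel"
    by (rule borel_measurable_continuous_onI)
  have int: "set_integrable lborel {0..2 * pi} (\<lambda>t. F (cis t))"
    by (intro borel_integrable_atLeastAtMost' continuous_on_subset[OF cont]) auto
  have "(\<integral>w. F w \<partial>circle_measure) = (\<integral>t. F (cis t) \<partial>uniform_measure lborel {0..<2 * pi})"
    unfolding circle_measure_def
    by (intro integral_distr measurable_cis borel_measurable_continuous_on_restrict F)
  also have "uniform_measure lborel {0..<2 * pi} =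
      density lborel (\<lambda>t. ennreal (indicator {0..<2 * pi} t / (2 * pi)))"
    unfolding uniform_measure_def
    by (intro arg_cong2[where f = density] ext refl) (simp add: divide_ennreal split: split_indicator flip: ennreal_1)
  also have "(\<integral>t. F (cis t) \<partial>\<dots>) = (\<integral>t. (indicator {0..<2 * pi} t / (2 * pi)) *\<^sub>R F (cis t) \<partial>lborel)"
    using meas by (intro integral_density) auto
  \<comment> \<open>The half-open interval becomes closed; the two integrands differ at most at
    \<open>2 * pi\<close>, a null set.\<close>
  also have "\<dots> = (\<integral>t. (1 / (2 * pi)) *\<^sub>R (indicator {0..2 * pi} t *\<^sub>R F (cis t)) \<partial>lborel)"
  proof (rule integral_cong_AE)
    show "AE t in lborel. (indicator {0..<2 * pi} t / (2 * pi)) *\<^sub>R F (cis t) =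
        (1 / (2 * pi)) *\<^sub>R (indicator {0..2 * pi} t *\<^sub>R F (cis t))"
      using AE_lborel_singleton[of "2 * pi"] by eventually_elim (auto simp: indicator_def)
  qed (use meas in measurable)
  also have "\<dots> = (1 / (2 * pi)) *\<^sub>R (LINT t:{0..2 * pi}|lborel. F (cis t))"
    unfolding set_lebesgue_integral_def by (rule integral_scaleR_right)
  finally have "(2 * pi) *\<^sub>R (\<integral>w. F w \<partial>circle_measure) = integral {0..2 * pi} (\<lambda>t. F (cis t))"
    using set_borel_integral_eq_integral(2)[OF int] by simp
  then show ?thesis
    using set_borel_integral_eq_integral(1)[OF int] by (simp add: integrable_integral)
qed

lemma continuous_on_circle:
  assumes "f holomorphic_on ball 0 1" "0 < r" "r < 1"
  shows "continuous_on (sphere 0 1) (\<lambda>w. f (of_real r * w))"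
proof (rule continuous_on_compose2[OF holomorphic_on_imp_continuous_on[OF assms(1)]])
  show "(\<lambda>w. complex_of_real r * w) ` sphere 0 1 \<subseteq> ball 0 1"
    using assms by (auto simp: norm_mult)
qed (intro continuous_intros)

lemma continuous_on_circle_powr:
  assumes "f holomorphic_on ball 0 1" "0 < r" "r < 1" "0 < p"
  shows "continuous_on (sphere 0 1) (\<lambda>w. norm (f (of_real r * w)) powr p)"
  using assms
  by (intro continuous_on_powr' continuous_on_norm continuous_on_circle continuous_intros) auto

lemma continuous_on_Cauchy_integrand:
  assumes f: "f holomorphic_on ball 0 1" and z: "norm z < r" and r: "r < 1"
  shows "continuous_on (sphere 0 1) (\<lambda>w. f (of_real r * w) * (of_real r * w / (of_real r * w - z)))"
proof -
  have r0: "0 < r"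
    using z norm_ge_zero[of z] by linarith
  moreover have "of_real r * w - z \<noteq> 0" if "w \<in> sphere 0 1" for w
    using that z r0 by (auto simp: norm_mult)
  ultimately show ?thesis
    using r by (intro continuous_intros continuous_on_circle f) auto
qed

text \<open>With \<open>u = r * w\<close>, normalised measure is
  \<open>du / (2 * pi * \<i> * u)\<close>; hence the Cauchy kernel \<open>1 / (u - z)\<close> picks
  up the factor \<open>u\<close>.\<close>

lemma Cauchy_formula_circle_measure:
  assumes f: "f holomorphic_on ball 0 1" and z: "norm z < r" and r: "r < 1"
  shows "f z = (\<integral>w. f (of_real r * w) * (of_real r * w / (of_real r * w - z)) \<partial>circle_measure)"
proof -
  define F where "F = (\<lambda>w. f (of_real r * w) * (of_real r * w / (of_real r * w - z)))"
  have F: "continuous_on (sphere 0 1) F"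
    unfolding F_def by (rule continuous_on_Cauchy_integrand[OF assms])
  have "((\<lambda>u. f u / (u - z)) has_contour_integral (2 * of_real pi * \<i> * f z)) (circlepath 0 r)"
    using z r by (intro Cauchy_integral_circlepath_simple holomorphic_on_subset[OF f]) auto
  \<comment> \<open>The derivative \<open>\<i> * r * cis t\<close> of the path supplies both the
    factor \<open>\<i>\<close> and the numerator \<open>r * w\<close> of \<open>F\<close>.\<close>
  then have "((\<lambda>t. \<i> * F (cis t)) has_integral (2 * of_real pi * \<i> * f z)) {0..2 * pi}"
    unfolding circlepath_def
    by (subst (asm) has_contour_integral_part_circlepath_iff) (simp_all add: F_def mult_ac)
  moreover have "((\<lambda>t. \<i> * F (cis t)) has_integral
      (\<i> * ((2 * pi) *\<^sub>R (\<integral>w. F w \<partial>circle_measure)))) {0..2 * pi}"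
    by (intro has_integral_mult_right has_integral_circle_measure F)
  ultimately have "2 * of_real pi * \<i> * f z = \<i> * ((2 * pi) *\<^sub>R (\<integral>w. F w \<partial>circle_measure))"
    by (rule has_integral_unique)
  then show ?thesis
    by (simp add: scaleR_conv_of_real F_def)
qed

text \<open>Removes the supremum and the root, leaving a bound on each p-th power mean; these bounds
  can be used one radius at a time and pass to limits.\<close>

lemma hardy_norm_le_iff:
  assumes "0 < p" "0 \<le> M"
  shows "hardy_norm p f \<le> ennreal M \<longleftrightarrow>
    (\<forall>r\<in>{0<..<1::real}. (\<integral>w. norm (f (of_real r * w)) powr p \<partial>circle_measure) \<le> M powr p)"
proof -
  have "x powr (1 / p) \<le> M \<longleftrightarrow> x \<le> M powr p" if "0 \<le> x" for x
  proof
    assume "x powr (1 / p) \<le> M"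
    then have "(x powr (1 / p)) powr p \<le> M powr p"
      using assms by (intro powr_mono2) auto
    then show "x \<le> M powr p"
      using assms that by (simp add: powr_powr)
  next
    assume "x \<le> M powr p"
    then have "x powr (1 / p) \<le> (M powr p) powr (1 / p)"
      using assms that by (intro powr_mono2) auto
    then show "x powr (1 / p) \<le> M"
      using assms by (simp add: powr_powr)
  qed
  then show ?thesis
    using assms by (simp add: hardy_norm_def SUP_le_iff ennreal_le_iff)
qed

text \<open>The constant is crude, but it depends only on \<open>p\<close>, \<open>M\<close> and
  \<open>norm z\<close>: it is the same for all functions in a Hardy ball and for all points of a
  circle about 0.\<close>

lemma hardy_norm_pointwise_bound:
  assumes f: "f holomorphic_on ball 0 1" and norm_f: "hardy_norm p f \<le> ennreal M"
    and p: "1 \<le> p" and M: "0 \<le> M" and z: "norm z < 1"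
  shows "norm (f z) \<le> 2 / (1 - norm z) * (1 + M powr p)"
proof -
  interpret prob_space circle_measure
    by (rule prob_space_circle_measure)
  \<comment> \<open>The midpoint of \<open>norm z\<close> and 1, so that \<open>r - norm z\<close>
    is half of \<open>1 - norm z\<close>; this is the source of the factor 2.\<close>
  define r where "r = (1 + norm z) / 2"
  have r: "norm z < r" "r < 1"
    using z by (auto simp: r_def)
  then have r0: "0 < r"
    using norm_ge_zero[of z] by linarith
  let ?h = "\<lambda>w. norm (f (of_real r * w)) powr p"
  have h: "integrable circle_measure ?h"
    using p r r0 by (intro continuous_on_sphere_integrable continuous_on_circle_powr f) auto
  have mean: "(\<integral>w. ?h w \<partial>circle_measure) \<le> M powr p"
    using norm_f p M r r0 by (subst (asm) hardy_norm_le_iff) auto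
  \<comment> \<open>Stands in for Hoelder's inequality: it trades the first power in the Cauchy
    formula for the p-th, and the extra 1 integrates to 1 over a probability measure.\<close>
  have powr_bound: "t \<le> 1 + t powr p" if "0 \<le> t" for t :: real
  proof (cases "t \<le> 1")
    case False
    then have "t powr 1 \<le> t powr p"
      using p by (intro powr_mono) auto
    then show ?thesis
      using False by simp
  qed (use powr_ge_zero[of t p] in linarith)
  have bound: "norm (f (of_real r * w) * (of_real r * w / (of_real r * w - z))) \<le>
      2 / (1 - norm z) * (1 + ?h w)" if w: "w \<in> sphere 0 1" for w
  proof -
    have "r - norm z \<le> norm (of_real r * w - z)"
      using norm_triangle_ineq2[of "of_real r * w" z] w r0 by (simp add: norm_mult)
    then have "norm (of_real r * w / (of_real r * w - z)) \<le> 1 / (r - norm z)"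
      using w r r0 by (auto simp: norm_divide norm_mult intro!: frac_le)
    also have "\<dots> = 2 / (1 - norm z)"
      using z by (simp add: r_def field_simps)
    finally show ?thesis
      using powr_bound[of "norm (f (of_real r * w))"] z
      by (subst norm_mult, subst mult.commute, intro mult_mono) auto
  qed
  have "norm (f z) = norm (\<integral>w. f (of_real r * w) * (of_real r * w / (of_real r * w - z)) \<partial>circle_measure)"
    using Cauchy_formula_circle_measure[OF f r] by simp
  also have "\<dots> \<le> (\<integral>w. 2 / (1 - norm z) * (1 + ?h w) \<partial>circle_measure)"
  proof (rule Bochner_Integration.integral_norm_bound_integral)
    show "integrable circle_measure
        (\<lambda>w. f (of_real r * w) * (of_real r * w / (of_real r * w - z)))"
      by (intro continuous_on_sphere_integrable continuous_on_Cauchy_integrand f r)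
  qed (use h bound in auto)
  also have "\<dots> = 2 / (1 - norm z) * (1 + (\<integral>w. ?h w \<partial>circle_measure))"
    using h prob_space by simp
  also have "\<dots> \<le> 2 / (1 - norm z) * (1 + M powr p)"
    using mean z by (intro mult_left_mono) auto
  finally show ?thesis .
qed

text \<open>Hardy balls are closed under pointwise limits that are holomorphic. The radius is fixed
  first, so that the pointwise bound gives a constant dominating function.\<close>

lemma hardy_norm_le_of_tendsto:
  assumes p: "1 \<le> p" and M: "0 \<le> M"
    and f: "\<And>k. f k holomorphic_on ball 0 1" and g: "g holomorphic_on ball 0 1"
    and norm_f: "\<And>k. hardy_norm p (f k) \<le> ennreal M"
    and lim: "\<And>z. z \<in> ball 0 1 \<Longrightarrow> (\<lambda>k. f k z) \<longlonglongrightarrow> g z"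
  shows "hardy_norm p g \<le> ennreal M"
proof -
  interpret prob_space circle_measure
    by (rule prob_space_circle_measure)
  have p0: "0 < p"
    using p by simp
  have "(\<integral>w. norm (g (of_real r * w)) powr p \<partial>circle_measure) \<le> M powr p"
    if "0 < r" "r < 1" for r :: real
  proof (rule LIMSEQ_le_const2)
    show "(\<lambda>k. \<integral>w. norm (f k (of_real r * w)) powr p \<partial>circle_measure)
        \<longlonglongrightarrow> (\<integral>w. norm (g (of_real r * w)) powr p \<partial>circle_measure)"
    proof (rule integral_dominated_convergence)
      show "integrable circle_measure (\<lambda>w. (2 / (1 - r) * (1 + M powr p)) powr p)"
        by simp
      \<comment> \<open>Zeros of \<open>g\<close> are harmless: since \<open>0 < p\<close>, the
        power is continuous at 0 along nonnegative values.\<close>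
      show "AE w in circle_measure. (\<lambda>k. norm (f k (of_real r * w)) powr p)
          \<longlonglongrightarrow> norm (g (of_real r * w)) powr p"
        using that p0 by (intro AE_I2 tendsto_powr' tendsto_norm lim tendsto_const) (auto simp: norm_mult)
      show "AE w in circle_measure. norm (norm (f k (of_real r * w)) powr p)
          \<le> (2 / (1 - r) * (1 + M powr p)) powr p" for k
      proof (rule AE_I2)
        fix w assume "w \<in> space circle_measure"
        then have "norm (of_real r * w) = r"
          using that by (simp add: norm_mult)
        then show "norm (norm (f k (of_real r * w)) powr p) \<le> (2 / (1 - r) * (1 + M powr p)) powr p"
          using hardy_norm_pointwise_bound[OF f norm_f p M, of "of_real r * w" k] that p0
          by (auto intro!: powr_mono2)
      qed
    qed (use that p0 f g in \<open>auto intro!: continuous_on_sphere_measurable continuous_on_circle_powr\<close>)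
    show "\<exists>N. \<forall>k\<ge>N. (\<integral>w. norm (f k (of_real r * w)) powr p \<partial>circle_measure) \<le> M powr p"
      using norm_f that by (simp add: hardy_norm_le_iff[OF p0 M])
  qed
  then show ?thesis
    by (simp add: hardy_norm_le_iff[OF p0 M])
qed

theorem theorem1:
  fixes p :: real and f :: "nat \<Rightarrow> complex \<Rightarrow> complex"
  assumes "1 \<le> p"
    and "\<And>n. f n \<in> hardy_space p"
    and "(SUP n. hardy_norm p (f n)) < \<infinity>"
  shows "\<exists>g \<in> hardy_space p. \<exists>\<phi> :: nat \<Rightarrow> nat. strict_mono \<phi> \<and>
           (\<forall>K. compact K \<and> K \<subseteq> ball 0 1 \<longrightarrow>
              uniform_limit K (\<lambda>k. f (\<phi> k)) g sequentially)"
proof -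
  \<comment> \<open>By assumption the supremum is finite, so \<open>enn2real\<close> does not fall
    back to its value 0 at infinity.\<close>
  define M where "M = enn2real (SUP n. hardy_norm p (f n))"
  have M: "0 \<le> M"
    by (simp add: M_def)
  have norm_f: "hardy_norm p (f n) \<le> ennreal M" for n
    using assms(3) SUP_upper[of n UNIV "\<lambda>n. hardy_norm p (f n)"] by (simp add: M_def)
  have hol: "f n holomorphic_on ball 0 1" for n
    using assms(2)[of n] by (simp add: hardy_space_def)
  have bounded: "\<exists>B. \<forall>h\<in>range f. \<forall>z\<in>K. norm (h z) \<le> B" if K: "compact K" "K \<subseteq> ball 0 1" for K
  proof (cases "K = {}")
    case False
    \<comment> \<open>The pointwise bound grows with \<open>norm z\<close>, so its value at a point
      of largest modulus serves all of \<open>K\<close>; that modulus is below 1 because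
      \<open>x\<close> lies in the disc.\<close>
    obtain x where x: "x \<in> K" "\<And>z. z \<in> K \<Longrightarrow> norm z \<le> norm x"
      using continuous_attains_sup[OF K(1) False, of norm] by (auto intro: continuous_intros)
    have "norm (f n z) \<le> 2 / (1 - norm x) * (1 + M powr p)" if "z \<in> K" for n z
    proof -
      have z: "norm z \<le> norm x" "norm x < 1"
        using x K that by auto
      then have "norm (f n z) \<le> 2 / (1 - norm z) * (1 + M powr p)"
        by (intro hardy_norm_pointwise_bound hol norm_f assms(1) M) simp
      also have "\<dots> \<le> 2 / (1 - norm x) * (1 + M powr p)"
        using z by (intro mult_right_mono frac_le) auto
      finally show ?thesis .
    qed
    then show ?thesis
      by blast
  qed simp
  have hol_range: "h holomorphic_on ball 0 1" if "h \<in> range f" for h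
    using that hol by auto
  \<comment> \<open>Montel's theorem for the family \<open>range f\<close>, with \<open>f\<close>
    itself as the sequence drawn from it.\<close>
  obtain g \<phi> where g: "g holomorphic_on ball 0 1" and \<phi>: "strict_mono (\<phi> :: nat \<Rightarrow> nat)"
    and lim: "\<And>z. z \<in> ball 0 1 \<Longrightarrow> (\<lambda>k. f (\<phi> k) z) \<longlonglongrightarrow> g z"
    and ulim: "\<And>K. compact K \<Longrightarrow> K \<subseteq> ball 0 1 \<Longrightarrow> uniform_limit K (f \<circ> \<phi>) g sequentially"
    by (rule Montel[OF open_ball hol_range bounded order_refl]) (assumption+, rule that, blast+)
  have "hardy_norm p g \<le> ennreal M"
    by (rule hardy_norm_le_of_tendsto[OF assms(1) M hol g norm_f lim])
  then have "g \<in> hardy_space p"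
    using g by (auto simp: hardy_space_def intro: le_less_trans)
  then show ?thesis
    using \<phi> ulim by (auto simp: o_def)
qed

end
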